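(* Let $G=(V,E)$ be a finite directed graph whose nodes carry geographic coordinates and whose edges are weighted by great-circle distance, let $P\subset V$ be a nonempty set of points of interest, and let $c\in\{I,O,A\}$ be an inconsistency type (inward, outward, or absolute). Let $R$ be the set of ordered pairs $\langle \mathrm{old}_p,\mathrm{new}_p\rangle$ output by the greedy relocation algorithm (described in the context) on input $(G,P,c)$. Then: (i) for every $\langle \mathrm{old}_p,\mathrm{new}_p\rangle\in R$, one has $\mathrm{old}_p\in P$, and $\mathrm{new}_p$ is a consistent node of $\mathrm{old}_p$, i.e. $\mathrm{new}_p\in V^{E}_{\mathrm{old}_p}(P)\setminus\Psi^{c}_{\mathrm{old}_p}(P)$, which has the highest straightness centrality in the subgraph of $G$ induced by $V^{E}_{\mathrm{old}_p}(P)\setminus\Psi^{c}_{\mathrm{old}_p}(P)$; (ii) replacing points of interest as prescribed by $R$ never increases the total number of inconsistencies: with $$P'=\bigl(P\setminus\{\mathrm{old}_p:\langle \mathrm{old}_p,\mathrm{new}_p\rangle\in R\}\bigr)\cup\{\mathrm{new}_p:\langle \mathrm{old}_p,\mathrm{new}_p\rangle\in R\},$$ one has $$\sum_{q\in P'}\bigl|\Psi^{c}_{q}(P')\bigr|\;\le\;\sum_{p\in P}\bigl|\Psi^{c}_{p}(P)\bigr|.$$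
   Context: **Network.** $G=(V,E)$ is a finite directed graph; an edge is an ordered pair $\langle i,j\rangle$ with $i\ne j$. Each node $i$ has a latitude $\mathrm{Lat}_i$ and a longitude $\mathrm{Lon}_i$ (in radians). The inline (great-circle) distance is $$d^{E}_{ij}=\mathcal R\arccos\bigl(\sin(\mathrm{Lat}_i)\sin(\mathrm{Lat}_j)+\cos(\mathrm{Lat}_i)\cos(\mathrm{Lat}_j)\cos(\mathrm{Lon}_i-\mathrm{Lon}_j)\bigr),\qquad \mathcal R=6378\text{ km}.$$ Each edge $\langle i,j\rangle$ has weight $d^{E}_{ij}$. The network distance $d^{N}_{ij}$ is the minimum total weight of a directed path from $i$ to $j$ ($d^N_{ii}=0$, and $d^N_{ij}=\infty$ if there is no such path). **Sets attached to a set of points of interest.** For a nonempty set $Q\subseteq V$ and $p\in Q$ define - the perimeter set $V^{E}_{p}(Q)=\{v\in V: d^{E}_{vp}<d^{E}_{v\bar p}\ \text{for all }\bar p\in Q,\ \bar p\ne p\}$; - the network set $V^{N}_{p}(Q)=\{v\in V: d^{N}_{vp}<d^{N}_{v\bar p}\ \text{for all }\bar p\in Q,\ \bar p\ne p\}$; - the reversed network set $\bar V^{N}_{p}(Q)=\{v\in V: d^{N}_{pv}<d^{N}_{\bar p v}\ \text{for all }\bar p\in Q,\ \bar p\ne p\}$. Standing assumption (no ties): for every set $Q$ of points of interest to which these definitions are applied, each $v\in V$ belongs to exactly one of the sets $V^E_p(Q)$, exactly one of the sets $V^N_p(Q)$, and exactly one of the sets $\bar V^N_p(Q)$, $p\in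 Q$. **Inconsistencies.** The inward, outward and absolute inconsistencies of $p\in Q$ are $$\Psi^{I}_{p}(Q)=V^{E}_{p}(Q)\setminus V^{N}_{p}(Q),\qquad \Psi^{O}_{p}(Q)=V^{E}_{p}(Q)\setminus \bar V^{N}_{p}(Q),\qquad \Psi^{A}_{p}(Q)=\Psi^{I}_{p}(Q)\cap\Psi^{O}_{p}(Q).$$ The consistent nodes of $p$ (of type $c$) are the elements of $V^{E}_{p}(Q)\setminus\Psi^{c}_{p}(Q)$. Write $T^{c}(Q)=\sum_{p\in Q}|\Psi^{c}_{p}(Q)|$ for the total number of inconsistencies. **Straightness centrality.** In a graph $H$ with $n$ nodes, the straightness centrality of a node $i$ is $\frac{1}{n-1}\sum_{j\ne i} d^{E}_{ij}/d^{N}_{ij}$, where $d^{N}$ is the network distance within $H$, terms with $d^N_{ij}=\infty$ count as $0$, and the value is $0$ if $n=1$. **Greedy relocation algorithm**, input $(G,P,c)$: 1. Initialise $R=\emptyset$, $\bar P=\emptyset$ (old locations already moved), $\tilde P=\emptyset$ (new locations), and $t=T^{c}(P)$ (best total so far). 2. While $|P|-|\bar P|>0$ and $T^{c}(P)\ge t$: - Set $\mathrm{old}_p$ and $\mathrm{new}_p$ to "undefined". - For each $p\in P\setminus\bar P$ (in any order): let $\bar p$ be a node of highest straightness centrality in the subgraph of $G$ induced by $V^{E}_{p}(P)\setminus\Psi^{c}_{p}(P)$ (ties broken by an arbitrary fixed rule); let $\mathbb P=\bigl(((P\setminus\bar P)\cup\tilde P)\setminus\{p\}\bigr)\cup\{\bar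 p\}$; if $t>T^{c}(\mathbb P)$, then set $t=T^{c}(\mathbb P)$, $\mathrm{old}_p=p$, $\mathrm{new}_p=\bar p$. - If $\mathrm{old}_p$ and $\mathrm{new}_p$ are defined, add $\langle\mathrm{old}_p,\mathrm{new}_p\rangle$ to $R$, add $\mathrm{old}_p$ to $\bar P$, and add $\mathrm{new}_p$ to $\tilde P$; otherwise exit the loop. 3. Return $R$. *)

theory Defs
  imports
    Complex_Main
    "HOL-Library.While_Combinator"
    "Graph_Theory.Pair_Digraph"
    "Graph_Theory.Digraph_Component"
    "Graph_Theory.Shortest_Path"
begin

record 'a geo_network =
  network_graph :: "'a pair_pre_digraph"
  lat :: "'a \<Rightarrow> real"
  lon :: "'a \<Rightarrow> real"

abbreviation nodes :: "'a geo_network \<Rightarrow> 'a set" where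
  "nodes N \<equiv> pverts (network_graph N)"

definition inline_dist :: "'a geo_network \<Rightarrow> 'a \<Rightarrow> 'a \<Rightarrow> real" where
  "inline_dist N i j =
     6378 * arccos (sin (lat N i) * sin (lat N j)
       + cos (lat N i) * cos (lat N j) * cos (lon N i - lon N j))"

text \<open>
  \<open>wf_digraph.\<mu>\<close> is the infimum of the costs of all walks in \<open>H\<close>, hence \<open>\<infinity>\<close> if there is none.
  Edge weights are nonnegative here, so it is the minimum over paths. The graph \<open>H\<close> is
  a separate argument because straightness uses distances inside induced subgraphs.
\<close>

definition network_dist ::
    "'a geo_network \<Rightarrow> ('a, 'a \<times> 'a) pre_digraph \<Rightarrow> 'a \<Rightarrow> 'a \<Rightarrow> ereal" where
  "network_dist N H i j = wf_digraph.\<mu> H (\<lambda>(u, v). inline_dist N u v) i j"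

definition perimeter_set :: "'a geo_network \<Rightarrow> 'a set \<Rightarrow> 'a \<Rightarrow> 'a set" where
  "perimeter_set N Q p =
     {v \<in> nodes N. \<forall>q\<in>Q. q \<noteq> p \<longrightarrow> inline_dist N v p < inline_dist N v q}"

definition network_set :: "'a geo_network \<Rightarrow> 'a set \<Rightarrow> 'a \<Rightarrow> 'a set" where
  "network_set N Q p =
     {v \<in> nodes N. \<forall>q\<in>Q. q \<noteq> p \<longrightarrow>
        network_dist N (with_proj (network_graph N)) v p < network_dist N (with_proj (network_graph N)) v q}"

definition reversed_network_set :: "'a geo_network \<Rightarrow> 'a set \<Rightarrow> 'a \<Rightarrow> 'a set" where
  "reversed_network_set N Q p =
     {v \<in> nodes N. \<forall>q\<in>Q. q \<noteq> p \<longrightarrow>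
        network_dist N (with_proj (network_graph N)) p v < network_dist N (with_proj (network_graph N)) q v}"

definition no_ties :: "'a geo_network \<Rightarrow> 'a set \<Rightarrow> bool" where
  "no_ties N Q \<longleftrightarrow>
     (\<forall>v\<in>nodes N. (\<exists>!p. p \<in> Q \<and> v \<in> perimeter_set N Q p)
        \<and> (\<exists>!p. p \<in> Q \<and> v \<in> network_set N Q p)
        \<and> (\<exists>!p. p \<in> Q \<and> v \<in> reversed_network_set N Q p))"

datatype inconsistency_type = Inward | Outward | Absolute

definition inward_inconsistency :: "'a geo_network \<Rightarrow> 'a set \<Rightarrow> 'a \<Rightarrow> 'a set" where
  "inward_inconsistency N Q p = perimeter_set N Q p - network_set N Q p"

definition outward_inconsistency :: "'a geo_network \<Rightarrow> 'a set \<Rightarrow> 'a \<Rightarrow> 'a set" where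
  "outward_inconsistency N Q p = perimeter_set N Q p - reversed_network_set N Q p"

fun inconsistency ::
    "'a geo_network \<Rightarrow> inconsistency_type \<Rightarrow> 'a set \<Rightarrow> 'a \<Rightarrow> 'a set" where
  "inconsistency N Inward Q p = inward_inconsistency N Q p"
| "inconsistency N Outward Q p = outward_inconsistency N Q p"
| "inconsistency N Absolute Q p = inward_inconsistency N Q p \<inter> outward_inconsistency N Q p"

definition consistent_nodes ::
    "'a geo_network \<Rightarrow> inconsistency_type \<Rightarrow> 'a set \<Rightarrow> 'a \<Rightarrow> 'a set" where
  "consistent_nodes N c Q p = perimeter_set N Q p - inconsistency N c Q p"

definition total_inconsistencies ::
    "'a geo_network \<Rightarrow> inconsistency_type \<Rightarrow> 'a set \<Rightarrow> nat" where
  "total_inconsistencies N c Q = (\<Sum>p\<in>Q. card (inconsistency N c Q p))"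

text \<open>
  For distinct nodes at the same position joined by an edge, the ratio is \<open>0 / 0\<close>, which is \<open>0\<close> in HOL.
\<close>

definition straightness ::
    "'a geo_network \<Rightarrow> ('a, 'a \<times> 'a) pre_digraph \<Rightarrow> 'a \<Rightarrow> real" where
  "straightness N H i =
     (if card (verts H) = 1 then 0
      else (\<Sum>j\<in>verts H - {i}.
              if network_dist N H i j = \<infinity> then 0
              else inline_dist N i j / real_of_ereal (network_dist N H i j))
           / (real (card (verts H)) - 1))"

definition consistent_subgraph ::
    "'a geo_network \<Rightarrow> inconsistency_type \<Rightarrow> 'a set \<Rightarrow> 'a \<Rightarrow> ('a, 'a \<times> 'a) pre_digraph" where
  "consistent_subgraph N c P p = with_proj (network_graph N) \<restriction> consistent_nodes N c P p"

text \<open>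
  The parameter \<open>pick\<close> is the tie-breaking rule, choosing an element of the set of nodes of highest
  straightness. The parameter \<open>ord\<close> lists the points \<open>P - moved s\<close> still to be
  processed in the order in which an iteration visits them; since this set strictly shrinks
  from each iteration to the next, a function of the set allows arbitrary orders in all iterations.
\<close>

definition relocation_target ::
    "'a geo_network \<Rightarrow> inconsistency_type \<Rightarrow> ('a set \<Rightarrow> 'a) \<Rightarrow> 'a set \<Rightarrow> 'a \<Rightarrow> 'a" where
  "relocation_target N c pick P p =
     (let H = consistent_subgraph N c P p
      in pick {v. is_arg_max (straightness N H) (\<lambda>u. u \<in> verts H) v})"

record 'a greedy_state =
  relocations :: "('a \<times> 'a) set"
  moved :: "'a set"
  placed :: "'a set"
  best :: nat
  stopped :: bool

definition greedy_init ::
    "'a geo_network \<Rightarrow> inconsistency_type \<Rightarrow> 'a set \<Rightarrow> 'a greedy_state" where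
  "greedy_init N c P =
     \<lparr>relocations = {}, moved = {}, placed = {},
      best = total_inconsistencies N c P, stopped = False\<rparr>"

definition greedy_continue ::
    "'a geo_network \<Rightarrow> inconsistency_type \<Rightarrow> 'a set \<Rightarrow> 'a greedy_state \<Rightarrow> bool" where
  "greedy_continue N c P s \<longleftrightarrow>
     \<not> stopped s \<and> card P > card (moved s) \<and> total_inconsistencies N c P \<ge> best s"

definition trial_set ::
    "'a geo_network \<Rightarrow> inconsistency_type \<Rightarrow> ('a set \<Rightarrow> 'a) \<Rightarrow> 'a set \<Rightarrow>
     'a greedy_state \<Rightarrow> 'a \<Rightarrow> 'a set" where
  "trial_set N c pick P s p =
     (((P - moved s) \<union> placed s) - {p}) \<union> {relocation_target N c pick P p}"

definition try_relocation ::
    "'a geo_network \<Rightarrow> inconsistency_type \<Rightarrow> ('a set \<Rightarrow> 'a) \<Rightarrow> 'a set \<Rightarrow>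
     'a greedy_state \<Rightarrow> 'a \<Rightarrow> nat \<times> ('a \<times> 'a) option \<Rightarrow> nat \<times> ('a \<times> 'a) option" where
  "try_relocation N c pick P s p = (\<lambda>(t, sel).
     let t' = total_inconsistencies N c (trial_set N c pick P s p)
     in if t > t' then (t', Some (p, relocation_target N c pick P p)) else (t, sel))"

definition greedy_step ::
    "'a geo_network \<Rightarrow> inconsistency_type \<Rightarrow> ('a set \<Rightarrow> 'a) \<Rightarrow> ('a set \<Rightarrow> 'a list) \<Rightarrow> 'a set \<Rightarrow>
     'a greedy_state \<Rightarrow> 'a greedy_state" where
  "greedy_step N c pick ord P s =
     (case fold (try_relocation N c pick P s) (ord (P - moved s)) (best s, None) of
        (t, None) \<Rightarrow> s\<lparr>best := t, stopped := True\<rparr>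
      | (t, Some (old, new)) \<Rightarrow>
          s\<lparr>relocations := insert (old, new) (relocations s),
            moved := insert old (moved s),
            placed := insert new (placed s),
            best := t\<rparr>)"

definition greedy_relocation ::
    "'a geo_network \<Rightarrow> inconsistency_type \<Rightarrow> ('a set \<Rightarrow> 'a) \<Rightarrow> ('a set \<Rightarrow> 'a list) \<Rightarrow> 'a set \<Rightarrow>
     ('a \<times> 'a) set" where
  "greedy_relocation N c pick ord P =
     relocations (while (greedy_continue N c P) (greedy_step N c pick ord P) (greedy_init N c P))"

text \<open>
  The standing assumption \<open>no_ties\<close> concerns the sets of points of interest
  whose inconsistencies the algorithm evaluates: \<open>P\<close> itself and the trial sets of all iterations.
\<close>

inductive greedy_reachable ::
    "'a geo_network \<Rightarrow> inconsistency_type \<Rightarrow> ('a set \<Rightarrow> 'a) \<Rightarrow> ('a set \<Rightarrow> 'a list) \<Rightarrow> 'a set \<Rightarrow>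
     'a greedy_state \<Rightarrow> bool"
  for N c pick ord P where
  init: "greedy_reachable N c pick ord P (greedy_init N c P)"
| step: "greedy_reachable N c pick ord P s \<Longrightarrow> greedy_continue N c P s \<Longrightarrow>
         greedy_reachable N c pick ord P (greedy_step N c pick ord P s)"

definition evaluated_sets ::
    "'a geo_network \<Rightarrow> inconsistency_type \<Rightarrow> ('a set \<Rightarrow> 'a) \<Rightarrow> ('a set \<Rightarrow> 'a list) \<Rightarrow> 'a set \<Rightarrow>
     'a set set" where
  "evaluated_sets N c pick ord P =
     {P} \<union> {trial_set N c pick P s p | s p.
              greedy_reachable N c pick ord P s \<and> greedy_continue N c P s \<and> p \<in> P - moved s}"

end

theory Submission
  imports Defs
begin

text \<open>
  After every iteration the best total is the number of inconsistencies of the current set of points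
  of interest, that is, \<open>P\<close> with all moved points replaced by their new locations. It starts at the
  total for \<open>P\<close> and only decreases.
  New locations exist because every point of interest is at distance \<open>0\<close> from itself and hence is one of
  its own consistent nodes.
\<close>

section \<open>Nonnegative distances and self-consistency\<close>

lemma inline_dist_nonneg: "0 \<le> inline_dist N i j"
proof -
  let ?a = "lat N i" and ?b = "lat N j" and ?t = "cos (lon N i - lon N j)"
  let ?x = "sin ?a * sin ?b + cos ?a * cos ?b * ?t"
  have t: "\<bar>cos ?a * cos ?b * ?t\<bar> \<le> \<bar>cos ?a * cos ?b\<bar>"
    using mult_left_mono [of "\<bar>?t\<bar>" 1 "\<bar>cos ?a * cos ?b\<bar>"] by (simp add: abs_mult)
  \<comment> \<open>Since \<open>?t\<close> has modulus at most 1, \<open>?x\<close> lies between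
    the values it would take for \<open>?t\<close> equal to 1 and -1, namely
    \<open>cos (?a - ?b)\<close> and \<open>- cos (?a + ?b)\<close>. Hence \<open>?x\<close> stays
    in the interval where \<open>arccos\<close> is known to be nonnegative.\<close>
  have "cos (?a + ?b) \<le> 1" "-1 \<le> cos (?a + ?b)" "cos (?a - ?b) \<le> 1" "-1 \<le> cos (?a - ?b)"
    by (rule cos_le_one cos_ge_minus_one)+
  then have "-1 \<le> ?x" "?x \<le> 1"
    using t unfolding cos_add cos_diff by linarith+
  then show ?thesis
    by (simp add: inline_dist_def arccos_lbound)
qed

lemma inline_dist_self: "inline_dist N i i = 0"
proof -
  have "sin (lat N i) * sin (lat N i) + cos (lat N i) * cos (lat N i) = 1"
    using sin_cos_squared_add [of "lat N i"] by (simp add: power2_eq_square)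
  then show ?thesis
    by (simp add: inline_dist_def)
qed

lemma network_dist_nonneg:
  assumes "wf_digraph H"
  shows "0 \<le> network_dist N H i j"
proof -
  interpret wf_digraph H by fact
  show ?thesis
    unfolding network_dist_def \<mu>_def
    by (auto intro!: INF_greatest pos_cost_pos_awalk_cost simp: inline_dist_nonneg)
qed

lemma network_dist_self:
  assumes "wf_digraph H" "i \<in> verts H"
  shows "network_dist N H i i = 0"
proof (rule antisym)
  interpret wf_digraph H by fact
  show "network_dist N H i i \<le> 0"
    \<comment> \<open>The empty walk at \<open>i\<close> costs 0; it is a walk because
      \<open>i\<close> is a vertex of \<open>H\<close>.\<close>
    using min_cost_le_walk_cost [of i "[]" i "\<lambda>(u, v). inline_dist N u v"] assms(2)
    by (simp add: network_dist_def awalk_Nil_iff zero_ereal_def)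
qed (rule network_dist_nonneg [OF assms(1)])

text \<open>
  By the no-ties assumption \<open>p\<close> lies in the set of some point of \<open>Q\<close>, and only \<open>p\<close> itself
  can be strictly closest to \<open>p\<close>.
\<close>

lemma self_consistent:
  assumes "wf_digraph (with_proj (network_graph N))" "no_ties N Q" "p \<in> Q" "p \<in> nodes N"
  shows "p \<in> consistent_nodes N c Q p"
proof -
  let ?G = "with_proj (network_graph N)"
  have pos: "\<not> inline_dist N p q < 0" "\<not> network_dist N ?G i j < 0" for q i j
    using inline_dist_nonneg [of N p q] network_dist_nonneg [OF assms(1), of N i j]
    by auto
  have self: "network_dist N ?G p p = 0"
    using assms by (intro network_dist_self) auto
  obtain q where "q \<in> Q" "p \<in> perimeter_set N Q q"
    using assms unfolding no_ties_def by blast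
  then have perimeter: "p \<in> perimeter_set N Q p"
    using assms(3) pos by (cases "q = p") (auto simp: perimeter_set_def inline_dist_self)
  obtain q where "q \<in> Q" "p \<in> network_set N Q q"
    using assms unfolding no_ties_def by blast
  then have network: "p \<in> network_set N Q p"
    using assms(3) pos by (cases "q = p") (auto simp: network_set_def self)
  obtain q where "q \<in> Q" "p \<in> reversed_network_set N Q q"
    using assms unfolding no_ties_def by blast
  then have reversed: "p \<in> reversed_network_set N Q p"
    using assms(3) pos by (cases "q = p") (auto simp: reversed_network_set_def self)
  show ?thesis
    using perimeter network reversed
    by (cases c) (auto simp: consistent_nodes_def inward_inconsistency_def outward_inconsistency_def)
qed

section \<open>Targets of highest straightness\<close>

lemma ex_is_arg_max_if_finite:
  fixes f :: "'a \<Rightarrow> 'b :: linorder"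
  assumes "finite S" "S \<noteq> {}"
  shows "\<exists>x. is_arg_max f (\<lambda>x. x \<in> S) x"
proof -
  have "Max (f ` S) \<in> f ` S"
    using assms by simp
  then obtain x where "x \<in> S" "f x = Max (f ` S)"
    by (metis imageE)
  then show ?thesis
    using assms by (auto simp: is_arg_max_linorder intro!: exI [of _ x])
qed

text \<open>The rule \<open>pick\<close> is only constrained on nonempty sets of nodes, so a
  maximiser must exist first. The candidates form a finite set, and \<open>p\<close> itself is one
  of them.\<close>

lemma relocation_target_is_arg_max:
  assumes "pair_digraph (network_graph N)"
    and pick: "\<forall>A. A \<noteq> {} \<and> A \<subseteq> nodes N \<longrightarrow> pick A \<in> A"
    and "no_ties N P" "p \<in> P" "P \<subseteq> nodes N"
  shows "is_arg_max (straightness N (consistent_subgraph N c P p))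
    (\<lambda>v. v \<in> consistent_nodes N c P p) (relocation_target N c pick P p)"
proof -
  interpret pair_digraph "network_graph N" by fact
  let ?S = "consistent_nodes N c P p"
  let ?A = "{v. is_arg_max (straightness N (consistent_subgraph N c P p)) (\<lambda>v. v \<in> ?S) v}"
  have sub: "?S \<subseteq> nodes N"
    by (auto simp: consistent_nodes_def perimeter_set_def)
  have "p \<in> ?S"
    using assms by (intro self_consistent) (auto intro: wf_digraph_axioms)
  then have "?A \<noteq> {}"
    using ex_is_arg_max_if_finite [of ?S] finite_subset [OF sub pair_finite_verts] by auto
  moreover have "?A \<subseteq> nodes N"
    using sub by (auto simp: is_arg_max_def)
  ultimately have "pick ?A \<in> ?A"
    by (intro pick [rule_format] conjI)
  \<comment> \<open>The vertices of an induced subgraph are exactly the inducing set, so maximising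
    over \<open>verts\<close> and over the consistent nodes agree.\<close>
  then show ?thesis
    by (simp add: relocation_target_def Let_def consistent_subgraph_def)
qed

section \<open>Invariant and termination of the greedy loop\<close>

lemma fold_try_relocation:
  assumes "fold (try_relocation N c pick P s) ps (t\<^sub>0, None) = (t, sel)"
  shows "case sel of None \<Rightarrow> t = t\<^sub>0
    | Some (p, v) \<Rightarrow> p \<in> set ps \<and> v = relocation_target N c pick P p
        \<and> t = total_inconsistencies N c (trial_set N c pick P s p) \<and> t < t\<^sub>0"
  using assms
\<comment> \<open>Induction from the right keeps the starting accumulator fixed and peels off the
  last trial. The bound and the selected pair change together, and only on strict
  improvement.\<close>
proof (induction ps arbitrary: t sel rule: rev_induct)
  case (snoc p ps)
  obtain t' sel' where *: "fold (try_relocation N c pick P s) ps (t\<^sub>0, None) = (t', sel')"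
    by fastforce
  have **: "try_relocation N c pick P s p (t', sel') = (t, sel)"
    using snoc.prems * by simp
  show ?case
    using snoc.IH [OF *] **
    by (auto simp: try_relocation_def Let_def split: if_splits option.splits)
qed simp

text \<open>Targets are taken with respect to the original \<open>P\<close>, so the first conjunct
  yields claim (i) at exit. The last two conjuncts yield claim (ii).\<close>

definition greedy_invariant ::
    "'a geo_network \<Rightarrow> inconsistency_type \<Rightarrow> ('a set \<Rightarrow> 'a) \<Rightarrow> 'a set \<Rightarrow> 'a greedy_state \<Rightarrow> bool" where
  "greedy_invariant N c pick P s \<longleftrightarrow>
     relocations s \<subseteq> (\<lambda>p. (p, relocation_target N c pick P p)) ` P
     \<and> moved s = fst ` relocations s \<and> placed s = snd ` relocations s
     \<and> best s = total_inconsistencies N c ((P - moved s) \<union> placed s)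
     \<and> best s \<le> total_inconsistencies N c P"

text \<open>
  A point not yet moved cannot be the target of a moved one, because the perimeter sets are disjoint.
  Hence removing it from the current set cannot remove a new location, and the trial set is the next
  set of points of interest.
\<close>

lemma trial_set_eq:
  assumes inv: "greedy_invariant N c pick P s"
    and "no_ties N P" "P \<subseteq> nodes N" and p: "p \<in> P - moved s"
    and target: "\<And>q. q \<in> P \<Longrightarrow> relocation_target N c pick P q \<in> perimeter_set N P q"
    and self: "p \<in> perimeter_set N P p"
  shows "trial_set N c pick P s p =
    (P - insert p (moved s)) \<union> insert (relocation_target N c pick P p) (placed s)"
proof -
  have "p \<notin> placed s"
  proof
    assume "p \<in> placed s"
    then obtain q where q: "q \<in> P" "q \<in> moved s" "p = relocation_target N c pick P q"
      using inv unfolding greedy_invariant_def by force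
    then have "p \<in> perimeter_set N P q"
      using target by simp
    moreover have "\<exists>!r. r \<in> P \<and> p \<in> perimeter_set N P r"
      using \<open>no_ties N P\<close> \<open>P \<subseteq> nodes N\<close> p unfolding no_ties_def by blast
    ultimately have "q = p"
      using q(1) p self by blast
    then show False
      using q(2) p by simp
  qed
  then show ?thesis
    by (auto simp: trial_set_def)
qed

text \<open>The disjunction serves termination: an iteration either raises the stop flag or moves a
  fresh point.\<close>

lemma greedy_step_cases:
  assumes inv: "greedy_invariant N c pick P s"
    and "no_ties N P" "P \<subseteq> nodes N"
    and target: "\<And>q. q \<in> P \<Longrightarrow> relocation_target N c pick P q \<in> perimeter_set N P q"
    and self: "\<And>q. q \<in> P \<Longrightarrow> q \<in> perimeter_set N P q"
    and ord: "set (ord (P - moved s)) = P - moved s"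
  shows "greedy_invariant N c pick P (greedy_step N c pick ord P s)
    \<and> (stopped (greedy_step N c pick ord P s) \<and> moved (greedy_step N c pick ord P s) = moved s
       \<or> (\<exists>p\<in>P - moved s. moved (greedy_step N c pick ord P s) = insert p (moved s)
            \<and> stopped (greedy_step N c pick ord P s) = stopped s))"
proof -
  obtain t sel where
    *: "fold (try_relocation N c pick P s) (ord (P - moved s)) (best s, None) = (t, sel)"
    by fastforce
  note result = fold_try_relocation [OF *]
  show ?thesis
  proof (cases sel)
    case None
    then have "greedy_step N c pick ord P s = s\<lparr>best := best s, stopped := True\<rparr>"
      using * result by (simp add: greedy_step_def)
    then show ?thesis
      using inv by (auto simp: greedy_invariant_def)
  next
    case (Some pv)
    then obtain p v where sel: "sel = Some (p, v)"
      by fastforce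
    with result ord have p: "p \<in> P - moved s" and v: "v = relocation_target N c pick P p"
      and t: "t = total_inconsistencies N c (trial_set N c pick P s p)" "t < best s"
      by auto
    \<comment> \<open>The successful trial set is the current set of the next state, so its total
      \<open>t\<close> is what the invariant demands of \<open>best\<close>.\<close>
    have "trial_set N c pick P s p = (P - insert p (moved s)) \<union> insert v (placed s)"
      unfolding v using assms p by (intro trial_set_eq) auto
    then show ?thesis
      using inv * sel p v t by (auto simp: greedy_step_def greedy_invariant_def)
  qed
qed

text \<open>The invariant holds initially and survives each step; a decreasing measure makes it hold
  for the result of \<open>while\<close>.\<close>

lemma greedy_relocation_invariant:
  assumes "finite P" "no_ties N P" "P \<subseteq> nodes N"
    and target: "\<And>q. q \<in> P \<Longrightarrow> relocation_target N c pick P q \<in> perimeter_set N P q"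
    and self: "\<And>q. q \<in> P \<Longrightarrow> q \<in> perimeter_set N P q"
    and ord: "\<And>A. A \<subseteq> P \<Longrightarrow> set (ord A) = A"
  shows "\<exists>s. greedy_invariant N c pick P s \<and> relocations s = greedy_relocation N c pick ord P"
proof -
  have step: "greedy_invariant N c pick P (greedy_step N c pick ord P s)
    \<and> (stopped (greedy_step N c pick ord P s) \<and> moved (greedy_step N c pick ord P s) = moved s
       \<or> (\<exists>p\<in>P - moved s. moved (greedy_step N c pick ord P s) = insert p (moved s)
            \<and> stopped (greedy_step N c pick ord P s) = stopped s))"
    if "greedy_invariant N c pick P s" for s
    using that assms by (intro greedy_step_cases) auto
  \<comment> \<open>The extra 1 pays for a final iteration that moves nothing and only raises the
    flag; \<open>greedy_continue\<close> ensures that the flag was down before.\<close>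
  let ?m = "\<lambda>s. card (P - moved s) + (if stopped s then 0 else 1)"
  have "greedy_invariant N c pick P
    (while (greedy_continue N c P) (greedy_step N c pick ord P) (greedy_init N c P))"
  proof (rule while_rule [where P = "greedy_invariant N c pick P" and r = "measure ?m"])
    show "greedy_invariant N c pick P (greedy_init N c P)"
      by (simp add: greedy_invariant_def greedy_init_def)
    show "(greedy_step N c pick ord P s, s) \<in> measure ?m"
      if "greedy_invariant N c pick P s" "greedy_continue N c P s" for s
    proof -
      have "card (P - insert p (moved s)) < card (P - moved s)" if "p \<in> P - moved s" for p
        using that \<open>finite P\<close> by (intro psubset_card_mono) auto
      then show ?thesis
        using step [OF that(1)] that(2) by (auto simp: greedy_continue_def)
    qed
  qed (use step in auto)
  then show ?thesis
    unfolding greedy_relocation_def by blast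
qed

theorem theorem1:
  fixes N :: "'a geo_network" and P :: "'a set" and c :: inconsistency_type
    and pick :: "'a set \<Rightarrow> 'a" and ord :: "'a set \<Rightarrow> 'a list"
    and R :: "('a \<times> 'a) set" and P' :: "'a set"
  assumes "pair_digraph (network_graph N)"
    and "P \<noteq> {}" and "P \<subseteq> nodes N"
    and pick: "\<forall>A. A \<noteq> {} \<and> A \<subseteq> nodes N \<longrightarrow> pick A \<in> A"
    and ord: "\<forall>A. A \<subseteq> P \<longrightarrow> distinct (ord A) \<and> set (ord A) = A"
    and no_ties: "\<forall>Q\<in>evaluated_sets N c pick ord P. no_ties N Q"
    and R: "R = greedy_relocation N c pick ord P"
    and P': "P' = (P - {old. \<exists>new. (old, new) \<in> R}) \<union> {new. \<exists>old. (old, new) \<in> R}"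
  shows "(\<forall>(old, new)\<in>R. old \<in> P
           \<and> new \<in> perimeter_set N P old - inconsistency N c P old
           \<and> is_arg_max
               (straightness N
                 (with_proj (network_graph N) \<restriction> (perimeter_set N P old - inconsistency N c P old)))
               (\<lambda>v. v \<in> perimeter_set N P old - inconsistency N c P old) new)
         \<and> (\<Sum>q\<in>P'. card (inconsistency N c P' q)) \<le> (\<Sum>p\<in>P. card (inconsistency N c P p))"
proof -
  interpret pair_digraph "network_graph N" by fact
  have ties: "no_ties N P"
    using no_ties by (simp add: evaluated_sets_def)
  have target: "is_arg_max (straightness N (consistent_subgraph N c P p))
      (\<lambda>v. v \<in> consistent_nodes N c P p) (relocation_target N c pick P p)" if "p \<in> P" for p
    using relocation_target_is_arg_max [OF assms(1) pick ties that assms(3)] .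
  have target_perimeter: "relocation_target N c pick P p \<in> perimeter_set N P p" if "p \<in> P" for p
    using target [OF that] by (simp add: is_arg_max_def consistent_nodes_def)
  have self: "p \<in> perimeter_set N P p" if "p \<in> P" for p
    using self_consistent [OF wf_digraph_axioms ties that, of c] that assms(3)
    by (auto simp: consistent_nodes_def)
  obtain s where s: "greedy_invariant N c pick P s" "relocations s = R"
    using greedy_relocation_invariant [OF finite_subset [OF assms(3) pair_finite_verts] ties assms(3)
        target_perimeter self] ord R by metis
  have img: "moved s = fst ` R" "placed s = snd ` R"
    using s unfolding greedy_invariant_def by simp_all
  \<comment> \<open>The two comprehensions defining \<open>P'\<close> are the domain and range of
    \<open>R\<close>, so \<open>P'\<close> is the current set of the final state.\<close>
  have "moved s = {old. \<exists>new. (old, new) \<in> R}" "placed s = {new. \<exists>old. (old, new) \<in> R}"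
    unfolding img Domain_fst [symmetric] Range_snd [symmetric] by blast+
  then have "P' = (P - moved s) \<union> placed s"
    using P' by simp
  then have "total_inconsistencies N c P' \<le> total_inconsistencies N c P"
    using s unfolding greedy_invariant_def by metis
  moreover have "old \<in> P \<and> new = relocation_target N c pick P old" if "(old, new) \<in> R" for old new
    using s that by (auto simp: greedy_invariant_def)
  ultimately show ?thesis
    using target
    by (auto simp: total_inconsistencies_def consistent_subgraph_def consistent_nodes_def is_arg_max_def)
qed

end
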